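(* Let $(P,\leq)$ be a finite poset and let $S$ be the multiset of all cardinalities of maximal chains in $P$. Let $m$ be the maximum element of $S$ and let $n=|S|$ (counting multiplicities). Then $|P|\geq m+\log_2(n)$.
   Context: A chain in a poset is a subset any two elements of which are comparable; a chain is maximal if it is not properly contained in any other chain. The multiset of cardinalities of maximal chains of $P$ contains one entry $|C|$ for each maximal chain $C$ of $P$, so its cardinality $|S|$ (counting multiplicities) equals the number of maximal chains of $P$. *)

theory Defs
  imports Complex_Main "HOL-Library.Multiset"
begin

text \<open>
  The library's maximal chains are taken with respect to the reflexive closure of the given
  predicate, which changes nothing when \<open>r\<close> is a partial order on \<open>P\<close>. The empty poset has
  exactly one maximal chain, namely \<open>{}\<close>.
\<close>

definition max_chains_on :: "'a set \<Rightarrow> 'a rel \<Rightarrow> 'a set set" where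
  "max_chains_on P r = {C. pred_on.maxchain P (\<lambda>x y. (x, y) \<in> r) C}"

definition max_chain_cards :: "'a set \<Rightarrow> 'a rel \<Rightarrow> nat multiset" where
  "max_chain_cards P r = image_mset card (mset_set (max_chains_on P r))"

text \<open>\<open>mset_set\<close> is empty on infinite sets, hence the following check.\<close>

lemma finite_max_chains_on: "finite P \<Longrightarrow> finite (max_chains_on P r)"
  by (rule finite_subset[of _ "Pow P"])
    (auto simp: max_chains_on_def pred_on.maxchain_def pred_on.chain_def)

end

theory Submission
  imports Defs
begin

text \<open>
  Fix any chain \<open>C\<close>. A maximal chain \<open>D\<close> is determined by \<open>D - C\<close>: if \<open>D\<close> and \<open>D'\<close> have the
  same part outside \<open>C\<close>, then an element of \<open>D - D'\<close> and one of \<open>D' - D\<close> both lie in \<open>C\<close>, so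
  \<open>D \<union> D'\<close> is a chain and maximality gives \<open>D = D'\<close>. Hence there are at most \<open>2 ^ card (P - C)\<close>
  maximal chains, and the theorem is the case where \<open>C\<close> has maximum cardinality.
\<close>

lemma inj_on_maxchain_Diff_chain:
  assumes C: "pred_on.chain P R C"
  shows "inj_on (\<lambda>D. D - C) {D. pred_on.maxchain P R D}"
proof (rule inj_onI)
  fix D D'
  assume mem: "D \<in> {D. pred_on.maxchain P R D}" "D' \<in> {D. pred_on.maxchain P R D}"
    and eq: "D - C = D' - C"
  have chains: "pred_on.chain P R D" "pred_on.chain P R D'"
    using mem by (auto simp: pred_on.maxchain_def)
  have "R\<^sup>=\<^sup>= x y \<or> R\<^sup>=\<^sup>= y x" if "x \<in> D \<union> D'" "y \<in> D \<union> D'" for x y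
  proof -
    have "(x \<in> D \<and> y \<in> D) \<or> (x \<in> D' \<and> y \<in> D') \<or> (x \<in> C \<and> y \<in> C)"
      using that eq by blast
    then show ?thesis
      using C chains unfolding pred_on.chain_def by blast
  qed
  then have "pred_on.chain P R (D \<union> D')"
    using chains unfolding pred_on.chain_def by blast
  then have "\<not> D \<subset> D \<union> D'" "\<not> D' \<subset> D \<union> D'"
    using mem by (auto simp: pred_on.maxchain_def)
  then show "D = D'"
    by blast
qed

text \<open>Deleting \<open>C\<close> maps the maximal chains injectively into the subsets of
  \<open>P - C\<close>. The truncated difference in the exponent is exact because \<open>C\<close>
  lies inside \<open>P\<close>.\<close>

lemma card_max_chains_on_le:
  assumes "finite P" and C: "pred_on.chain P (\<lambda>x y. (x, y) \<in> r) C"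
  shows "card (max_chains_on P r) \<le> 2 ^ (card P - card C)"
proof -
  have "C \<subseteq> P"
    using C by (simp add: pred_on.chain_def)
  have "card (max_chains_on P r) \<le> card (Pow (P - C))"
  proof (rule card_inj_on_le)
    show "inj_on (\<lambda>D. D - C) (max_chains_on P r)"
      unfolding max_chains_on_def by (rule inj_on_maxchain_Diff_chain[OF C])
    show "(\<lambda>D. D - C) ` max_chains_on P r \<subseteq> Pow (P - C)"
      by (auto simp: max_chains_on_def pred_on.maxchain_def pred_on.chain_def)
  qed (use \<open>finite P\<close> in simp)
  also have "\<dots> = 2 ^ (card P - card C)"
    using \<open>finite P\<close> \<open>C \<subseteq> P\<close> by (simp add: card_Pow card_Diff_subset finite_subset)
  finally show ?thesis .
qed

theorem theorem1:
  fixes P :: "'a set" and r :: "'a rel" and S :: "nat multiset" and m n :: nat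
  assumes "finite P"
    and "partial_order_on P r"
    and "S = max_chain_cards P r"
    and "m = Max (set_mset S)"
    and "n = size S"
  shows "real (card P) \<ge> real m + log 2 (real n)"
proof -
  have fin: "finite (max_chains_on P r)"
    using \<open>finite P\<close> by (rule finite_max_chains_on)
  \<comment> \<open>Hausdorff's maximal principle supplies a maximal chain, also for empty
    \<open>P\<close>. Hence \<open>Max\<close> is attained and \<open>n\<close> is positive.\<close>
  have nonempty: "max_chains_on P r \<noteq> {}"
    using pred_on.Hausdorff[of P "\<lambda>x y. (x, y) \<in> r"] by (auto simp: max_chains_on_def)
  have set_S: "set_mset S = card ` max_chains_on P r"
    using assms(3) fin by (simp add: max_chain_cards_def)
  have "m \<in> card ` max_chains_on P r"
    unfolding assms(4) set_S using fin nonempty by (intro Max_in) auto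
  then obtain C where C: "pred_on.chain P (\<lambda>x y. (x, y) \<in> r) C" and m: "m = card C"
    by (auto simp: max_chains_on_def pred_on.maxchain_def)
  \<comment> \<open>Lets \<open>card P - m\<close> become a genuine difference of reals at the
    end.\<close>
  have "m \<le> card P"
    using C m \<open>finite P\<close> by (simp add: pred_on.chain_def card_mono)
  have n: "n = card (max_chains_on P r)"
    using assms(3,5) by (simp add: max_chain_cards_def)
  then have "0 < n"
    using fin nonempty by (simp add: card_gt_0_iff)
  have "n \<le> 2 ^ (card P - m)"
    unfolding n m using \<open>finite P\<close> C by (rule card_max_chains_on_le)
  then have "real n \<le> 2 ^ (card P - m)"
    by (metis of_nat_le_iff of_nat_numeral of_nat_power)
  \<comment> \<open>\<open>log_le_iff\<close> requires a positive argument, and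
    \<open>powr_realpow\<close> identifies the real power of 2 with the natural one.\<close>
  then have "log 2 (real n) \<le> real (card P - m)"
    using \<open>0 < n\<close> by (simp add: log_le_iff powr_realpow)
  then show ?thesis
    using \<open>m \<le> card P\<close> by (simp add: of_nat_diff)
qed

end
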